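(* Let $l$ be a positive integer and let $m$ be a nonnegative integer. For any integer $N>1$, we have $$\sum_{0<n<N}\frac{(-1)^{mn}q^{-m\binom n2-(l+1)n}}{[n]_q^{m-1}}\,[l+1]_{q^n}\,S_l^{(m)}(n;q)\equiv 0\pmod{\Phi_N(q)}.$$
   Context: Here $q$ is an indeterminate and $\mathbb N=\{0,1,2,\ldots\}$. For $n\in\mathbb N$, $[n]_q=\frac{1-q^n}{1-q}=\sum_{0\le k<n}q^k$, and $[l+1]_{q^n}=\frac{1-q^{(l+1)n}}{1-q^n}=\sum_{k=0}^{l}q^{kn}$ is the same expression with $q$ replaced by $q^n$. Put $[0]_q!=1$ and $[n]_q!=\prod_{k=1}^n[k]_q$ for $n\ge1$. For $k_1,\ldots,k_l\in\mathbb N$ with $k_1+\cdots+k_l=n$, the $q$-multinomial coefficient is $$\left[{n\atop k_1,\ldots,k_l}\right]_q:=\frac{[n]_q!}{[k_1]_q!\cdots[k_l]_q!},$$ which is a polynomial in $q$ with integer coefficients. For a positive integer $l$ and $m,n\in\mathbb N$, define the polynomial $$S_l^{(m)}(n;q):=\sum_{\substack{k_1,\ldots,k_l\in\mathbb N\\ k_1+\cdots+k_l=n}}q^{\sum_{j=1}^l jk_j}\left[{n\atop k_1,\ldots,k_l}\right]_q^m.$$ For a positive integer $N$, $\Phi_N(q)=\prod_{1\le a\le N,\ \gcd(a,N)=1}\left(q-e^{2\pi i a/N}\right)$ is the $N$-th cyclotomic polynomial, which is irreducible in $\mathbb Z[q]$; for $0<n<N$ the polynomial $[n]_q$ is relatively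 prime to $\Phi_N(q)$, and so is $q$. The congruence modulo $\Phi_N(q)$ is between rational functions in $q$ over $\mathbb Q$ whose denominators are relatively prime to $\Phi_N(q)$: $A(q)\equiv 0\pmod{\Phi_N(q)}$ means that $A(q)=\Phi_N(q)B(q)/C(q)$ for some polynomials $B(q),C(q)\in\mathbb Q[q]$ with $C(q)$ relatively prime to $\Phi_N(q)$. *)

theory Defs
  imports
    Complex_Main
    "HOL-Library.FuncSet"
    "HOL-Computational_Algebra.Computational_Algebra"
begin

text \<open>
  The definitions below are stated for an element \<open>q\<close> of an arbitrary field.  They have the intended
  meaning when \<open>q\<close> is not a root of unity, in particular for the indeterminate of \<open>\<rat>(q)\<close>; otherwise the
  quotient in the multinomial coefficient may have a vanishing denominator.
\<close>

definition q_int :: "'a::field \<Rightarrow> nat \<Rightarrow> 'a" where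
  "q_int q n = (\<Sum>k<n. q ^ k)"

definition q_fact :: "'a::field \<Rightarrow> nat \<Rightarrow> 'a" where
  "q_fact q n = (\<Prod>k=1..n. q_int q k)"

definition q_multinomial :: "'a::field \<Rightarrow> nat \<Rightarrow> nat \<Rightarrow> (nat \<Rightarrow> nat) \<Rightarrow> 'a" where
  "q_multinomial q n l k = q_fact q n / (\<Prod>j=1..l. q_fact q (k j))"

text \<open>
  A tuple \<open>(k\<^sub>1, \<dots>, k\<^sub>l)\<close> is an extensional function on \<open>{1..l}\<close>; without extensionality
  the index set of the sum would be infinite.
\<close>

definition weak_compositions :: "nat \<Rightarrow> nat \<Rightarrow> (nat \<Rightarrow> nat) set" where
  "weak_compositions l n = {k \<in> {1..l} \<rightarrow>\<^sub>E UNIV. (\<Sum>j=1..l. k j) = n}"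

lemma finite_weak_compositions: "finite (weak_compositions l n)"
proof (rule finite_subset)
  show "weak_compositions l n \<subseteq> {1..l} \<rightarrow>\<^sub>E {..n}"
  proof
    fix k assume k: "k \<in> weak_compositions l n"
    have "k j \<le> n" if "j \<in> {1..l}" for j
      using k that member_le_sum[of j "{1..l}" k] by (auto simp: weak_compositions_def)
    with k show "k \<in> {1..l} \<rightarrow>\<^sub>E {..n}"
      by (auto simp: weak_compositions_def PiE_iff)
  qed
  show "finite ({1..l} \<rightarrow>\<^sub>E {..n})"
    by (intro finite_PiE) auto
qed

definition S_sum :: "nat \<Rightarrow> nat \<Rightarrow> nat \<Rightarrow> 'a::field \<Rightarrow> 'a" where
  "S_sum l m n q = (\<Sum>k\<in>weak_compositions l n. q ^ (\<Sum>j=1..l. j * k j) * q_multinomial q n l k ^ m)"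

definition cyclotomic_complex :: "nat \<Rightarrow> complex poly" where
  "cyclotomic_complex N =
     (\<Prod>a | 1 \<le> a \<and> a \<le> N \<and> coprime a N. [:- exp (2 * of_real pi * \<i> * of_nat a / of_nat N), 1:])"

text \<open>
  The coefficients of the cyclotomic polynomial are rational, so for \<open>N > 0\<close> the polynomial over
  \<open>\<rat>\<close> below exists; see \<open>of_rat_cyclotomic\<close>.
\<close>

definition cyclotomic :: "nat \<Rightarrow> rat poly" where
  "cyclotomic N = (THE p. map_poly of_rat p = cyclotomic_complex N)"

abbreviation rat_cpoly :: "rat poly \<Rightarrow> complex poly" where
  "rat_cpoly \<equiv> map_poly of_rat"

lemma rat_cpoly_add: "rat_cpoly (p + r) = rat_cpoly p + rat_cpoly r"
  by (intro poly_eqI) (simp add: coeff_map_poly of_rat_add)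

lemma rat_cpoly_mult: "rat_cpoly (p * r) = rat_cpoly p * rat_cpoly r"
  by (intro poly_eqI) (simp add: coeff_map_poly coeff_mult of_rat_sum of_rat_mult)

lemma rat_cpoly_prod: "rat_cpoly (\<Prod>x\<in>A. f x) = (\<Prod>x\<in>A. rat_cpoly (f x))"
  by (induction A rule: infinite_finite_induct) (simp_all add: rat_cpoly_mult)

lemma rat_cpoly_eq_iff: "rat_cpoly p = rat_cpoly r \<longleftrightarrow> p = r"
  by (auto simp: poly_eq_iff coeff_map_poly)

lemma degree_rat_cpoly: "degree (rat_cpoly p) = degree p"
  by (rule degree_map_poly) auto

lemma prod_cyclotomic_complex:
  assumes "N > 0"
  shows "(\<Prod>d | d dvd N. cyclotomic_complex d) = monom 1 N - 1"
proof -
  define w where "w a d = exp (2 * of_real pi * \<i> * of_nat a / of_nat d :: complex)" for a d :: nat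
  have w_cis: "w a d = cis (2 * pi * real a / real d)" for a d
    by (simp add: w_def cis_conv_exp mult_ac)
  have w_scale: "w (a * e) (d * e) = w a d" if "e > 0" for a d e
    using that by (simp add: w_def mult_ac)
  have fin: "finite {d. d dvd N}"
    using assms by simp
  have "(\<Prod>d | d dvd N. cyclotomic_complex d) =
        (\<Prod>(d, a)\<in>(SIGMA d:{d. d dvd N}. {a. 1 \<le> a \<and> a \<le> d \<and> coprime a d}). [:- w a d, 1:])"
    unfolding cyclotomic_complex_def w_def by (intro prod.Sigma) (use fin in auto)
  also have "\<dots> = (\<Prod>a\<in>{1..N}. [:- w a N, 1:])"
  proof (rule prod.reindex_bij_witness[where
        i = "\<lambda>a. (N div gcd a N, a div gcd a N)" and j = "\<lambda>(d, a). a * (N div d)"], goal_cases)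
    case (1 x)
    then obtain d a where x: "x = (d, a)" "d dvd N" "1 \<le> a" "a \<le> d" "coprime a d" by auto
    from x(2) obtain e where e: "N = d * e" by auto
    have pos: "d > 0" "e > 0" using assms e by auto
    have "gcd (a * e) (d * e) = e"
      using x(5) by (simp add: gcd_mult_distrib_nat[symmetric] mult.commute[of _ e])
    with pos show ?case by (simp add: x(1) e)
  next
    case (2 x)
    then obtain d a where x: "x = (d, a)" "d dvd N" "1 \<le> a" "a \<le> d" "coprime a d" by auto
    from x(2) obtain e where e: "N = d * e" by auto
    have pos: "d > 0" "e > 0" using assms e by auto
    with x(3,4) show ?case by (simp add: x(1) e)
  next
    case (3 a)
    define e where "e = gcd a N"
    have "e > 0" "e dvd a" "e dvd N" using assms by (auto simp: e_def)
    then obtain b c where "a = e * b" "N = e * c" by (auto elim!: dvdE)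
    with \<open>e > 0\<close> assms have "a div e * (N div (N div e)) = a" by simp
    then show ?case by (simp add: e_def)
  next
    case (4 a)
    define e where "e = gcd a N"
    have e: "e > 0" "e dvd a" "e dvd N" using assms by (auto simp: e_def)
    have "a div e \<le> N div e" "a div e > 0" "N div e dvd N"
      using 4 e by (auto simp: div_le_mono div_greater_zero_iff dvd_imp_le)
    moreover have "coprime (a div e) (N div e)"
      unfolding e_def by (rule div_gcd_coprime) (use assms in auto)
    ultimately show ?case by (simp add: e_def)
  next
    case (5 x)
    then obtain d a where x: "x = (d, a)" "d dvd N" "1 \<le> a" "a \<le> d" "coprime a d" by auto
    from x(2) obtain e where e: "N = d * e" by auto
    have pos: "d > 0" "e > 0" using assms e by auto
    then show ?case by (simp add: x(1) e w_scale)
  qed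
  also have "\<dots> = (\<Prod>a<N. [:- w a N, 1:])"
  proof -
    define F where "F a = [:- w a N, 1:]" for a
    have F: "F N = F 0" using assms by (simp add: F_def w_cis)
    obtain M where M: "N = Suc M" using assms gr0_implies_Suc by blast
    have "(\<Prod>a\<in>{1..N}. F a) = (\<Prod>a<N. F (Suc a))"
      using prod.atLeast1_atMost_eq[of F N] by simp
    also have "\<dots> = F N * (\<Prod>a<M. F (Suc a))"
      unfolding M prod.lessThan_Suc by (rule mult.commute)
    also have "\<dots> = (\<Prod>a<N. F a)"
      unfolding F M prod.lessThan_Suc_shift by (simp add: F[unfolded M])
    finally show ?thesis by (simp only: F_def)
  qed
  also have "\<dots> = (\<Prod>z | z ^ N = 1. [:- z, 1:])"
    using prod.reindex_bij_betw[OF bij_betw_roots_unity[OF assms], of "\<lambda>z. [:- z, 1:]"]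
    by (simp add: w_cis)
  also have "\<dots> = monom 1 N - 1"
  proof (rule poly_eqI_degree_lead_coeff[where A = "{z. z ^ N = 1}" and n = N])
    have card: "card {z :: complex. z ^ N = 1} = N"
      by (rule card_roots_unity_eq) fact
    show "N \<le> card {z :: complex. z ^ N = 1}" by (simp add: card)
    show "poly (\<Prod>z | z ^ N = 1. [:- z, 1:]) z = poly (monom 1 N - 1) z"
      if "z \<in> {z. z ^ N = 1}" for z :: complex
      using that assms by (auto simp: poly_prod poly_monom finite_roots_unity intro!: prod_zero bexI[of _ z])
    have deg: "degree (\<Prod>z | z ^ N = 1. [:- z :: complex, 1:]) = N"
      by (subst degree_prod_eq_sum_degree) (simp_all add: card)
    then show "degree (\<Prod>z | z ^ N = 1. [:- z :: complex, 1:]) \<le> N" by simp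
    show "degree (monom 1 N - 1 :: complex poly) \<le> N"
      by (intro degree_diff_le) (simp_all add: degree_monom_le)
    have "lead_coeff (\<Prod>z | z ^ N = 1. [:- z :: complex, 1:]) = 1"
      by (simp add: lead_coeff_prod)
    with deg show "coeff (\<Prod>z | z ^ N = 1. [:- z :: complex, 1:]) N = coeff (monom 1 N - 1) N"
      using assms by simp
  qed
  finally show ?thesis .
qed

lemma ex_rat_cyclotomic: "N > 0 \<Longrightarrow> \<exists>p. rat_cpoly p = cyclotomic_complex N"
proof (induction N rule: less_induct)
  case (less N)
  define D where "D = {d. d dvd N \<and> d \<noteq> N}"
  have "\<exists>p. rat_cpoly p = cyclotomic_complex d" if "d \<in> D" for d
  proof (rule less.IH)
    have "d dvd N" "d \<noteq> N" using that by (simp_all add: D_def)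
    then show "d < N" using dvd_imp_le[of d N] less.prems by simp
    from \<open>d dvd N\<close> show "d > 0" using dvd_pos_nat[OF less.prems] by simp
  qed
  then obtain f where f: "\<And>d. d \<in> D \<Longrightarrow> rat_cpoly (f d) = cyclotomic_complex d"
    by metis
  define g where "g = (\<Prod>d\<in>D. f d)"
  define X where "X = (monom 1 N - 1 :: rat poly)"
  define u where "u = X div g"
  define r where "r = X mod g"
  have finD: "finite D" using less.prems by (simp add: D_def)
  have g: "rat_cpoly g = (\<Prod>d\<in>D. cyclotomic_complex d)"
    by (simp add: g_def rat_cpoly_prod f)
  have "rat_cpoly g \<noteq> 0"
    unfolding g using finD by (auto simp: cyclotomic_complex_def)
  then have g0: "g \<noteq> 0" by auto
  have XC: "rat_cpoly X = monom 1 N - 1"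
    by (intro poly_eqI) (simp add: X_def coeff_map_poly of_rat_diff)
  have "{d. d dvd N} = insert N D" "N \<notin> D" by (auto simp: D_def)
  then have "monom 1 N - 1 = cyclotomic_complex N * rat_cpoly g"
    using prod_cyclotomic_complex[OF less.prems] finD by (simp add: g)
  moreover have "rat_cpoly X = rat_cpoly u * rat_cpoly g + rat_cpoly r"
    by (simp flip: rat_cpoly_mult rat_cpoly_add add: u_def r_def)
  ultimately have eq: "rat_cpoly r = (cyclotomic_complex N - rat_cpoly u) * rat_cpoly g"
    by (simp add: XC algebra_simps)
  have "cyclotomic_complex N - rat_cpoly u = 0"
  proof (rule ccontr)
    assume nz: "cyclotomic_complex N - rat_cpoly u \<noteq> 0"
    have "degree (rat_cpoly r) = degree (cyclotomic_complex N - rat_cpoly u) + degree (rat_cpoly g)"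
      unfolding eq by (rule degree_mult_eq) fact+
    moreover have "r \<noteq> 0"
      using eq nz \<open>rat_cpoly g \<noteq> 0\<close> by auto
    ultimately have "degree g \<le> degree r" "r \<noteq> 0"
      by (simp_all add: degree_rat_cpoly)
    then show False
      using degree_mod_less[OF g0, of X] by (auto simp: r_def)
  qed
  then show ?case by (intro exI[of _ u]) simp
qed

lemma of_rat_cyclotomic: "N > 0 \<Longrightarrow> map_poly of_rat (cyclotomic N) = cyclotomic_complex N"
  unfolding cyclotomic_def
  by (rule theI'[of "\<lambda>p. map_poly of_rat p = cyclotomic_complex N"])
    (metis ex_rat_cyclotomic rat_cpoly_eq_iff)

definition indet :: "rat poly fract" where
  "indet = to_fract [:0, 1:]"

definition ratfun_cong_0 :: "rat poly fract \<Rightarrow> rat poly \<Rightarrow> bool" where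
  "ratfun_cong_0 A P \<longleftrightarrow>
     (\<exists>B C. C \<noteq> 0 \<and> coprime C P \<and> A = to_fract P * to_fract B / to_fract C)"

end

theory Submission
  imports Defs
begin

text \<open>
  It suffices that the sum vanishes when \<open>q\<close> is a primitive \<open>N\<close>-th root of unity.  For such \<open>q\<close>, write
  \<open>f(x)\<close> for the sum of \<open>x\<^sup>k / ([k]!)\<^sup>m\<close> over \<open>k < N\<close>.  Since \<open>q\<^sup>N = 1\<close>, the factor
  \<open>(-1)\<^sup>n q\<^bsup>-n(n-1)/2\<^esup> / [n]\<close> equals \<open>- [N-1]! / ([n]! [N-n]!)\<close>, and
  \<open>(1 - q) q\<^bsup>-(l+1)n\<^esup> [n] [l+1]\<close>, the last factor taken at \<open>q\<^sup>n\<close>, equals \<open>q\<^bsup>(l+1)(N-n)\<^esup> - 1\<close>.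
  As \<open>S\<^sub>l(n) / ([n]!)\<^sup>m\<close> is the coefficient of \<open>x\<^sup>n\<close> in \<open>f(qx) \<cdots> f(q\<^sup>l x)\<close>, the sum is a multiple of
  the coefficient of \<open>x\<^sup>N\<close> in \<open>(f(q\<^bsup>l+1\<^esup> x) - f(x)) f(qx) \<cdots> f(q\<^sup>l x) = G(qx) - G(x)\<close>, where
  \<open>G(x) = f(x) f(qx) \<cdots> f(q\<^sup>l x)\<close>; this coefficient is \<open>q\<^sup>N - 1 = 0\<close> times that of \<open>G\<close>.
\<close>

section \<open>Coefficients of products of power series and the shift by \<open>q\<close>\<close>

lemma weak_compositions_le:
  assumes "k \<in> weak_compositions l n" "j \<in> {1..l}"
  shows "k j \<le> n"
  using assms member_le_sum[of j "{1..l}" k] by (auto simp: weak_compositions_def)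

text \<open>Induction on \<open>l\<close> with the last factor split off: in the Cauchy product,
  \<open>i\<close> is the sum of the first \<open>l\<close> entries and \<open>n - i\<close> is the
  last entry.\<close>

lemma fps_nth_prod_weak_compositions:
  fixes F :: "nat \<Rightarrow> 'a::comm_ring_1 fps"
  shows "fps_nth (\<Prod>j=1..l. F j) n = (\<Sum>k\<in>weak_compositions l n. \<Prod>j=1..l. fps_nth (F j) (k j))"
proof (induction l arbitrary: n)
  case 0
  \<comment> \<open>The only extensional function on the empty index set is constantly
    \<open>undefined\<close>, and its empty sum is 0.\<close>
  have "weak_compositions 0 n = (if n = 0 then {\<lambda>_. undefined} else {})"
    by (auto simp: weak_compositions_def)
  then show ?case by simp
next
  case (Suc l)
  have "fps_nth (\<Prod>j=1..Suc l. F j) n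
      = (\<Sum>i=0..n. \<Sum>k\<in>weak_compositions l i.
          (\<Prod>j=1..l. fps_nth (F j) (k j)) * fps_nth (F (Suc l)) (n - i))"
    by (simp add: fps_mult_nth Suc.IH[unfolded One_nat_def] sum_distrib_right)
  also have "\<dots> = (\<Sum>(i, k)\<in>(SIGMA i:{0..n}. weak_compositions l i).
          (\<Prod>j=1..l. fps_nth (F j) (k j)) * fps_nth (F (Suc l)) (n - i))"
    by (intro sum.Sigma) (auto simp: finite_weak_compositions)
  also have "\<dots> = (\<Sum>k\<in>weak_compositions (Suc l) n. \<Prod>j=1..Suc l. fps_nth (F j) (k j))"
  \<comment> \<open>Appending the entry \<open>n - i\<close> is undone by resetting it to
    \<open>undefined\<close>, which keeps the shorter tuple extensional.\<close>
  proof (rule sum.reindex_bij_witness[where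
        i = "\<lambda>k. (n - k (Suc l), k(Suc l := undefined))" and j = "\<lambda>(i, k). k(Suc l := n - i)"], goal_cases)
    case (1 x)
    then obtain i k where x: "x = (i, k)" "i \<le> n" "k \<in> weak_compositions l i" by auto
    then have "k (Suc l) = undefined"
      by (auto simp: weak_compositions_def PiE_iff extensional_def)
    then show ?case using x by (auto simp: fun_upd_idem)
  next
    case (2 x)
    then obtain i k where x: "x = (i, k)" "i \<le> n" "k \<in> weak_compositions l i" by auto
    have "(\<Sum>j=1..l. (k(Suc l := n - i)) j) = (\<Sum>j=1..l. k j)"
      by (intro sum.cong) auto
    then show ?case using x
      by (auto simp: weak_compositions_def PiE_iff extensional_def)
  next
    case (3 k)
    then show ?case by (auto simp: weak_compositions_def)
  next
    case (4 k)
    have "(\<Sum>j=1..l. (k(Suc l := undefined)) j) = (\<Sum>j=1..l. k j)"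
      by (intro sum.cong) auto
    then show ?case using 4
      by (auto simp: weak_compositions_def PiE_iff extensional_def)
  next
    case (5 x)
    then obtain i k where x: "x = (i, k)" "i \<le> n" "k \<in> weak_compositions l i" by auto
    have "(\<Prod>j=1..l. fps_nth (F j) ((k(Suc l := n - i)) j)) = (\<Prod>j=1..l. fps_nth (F j) (k j))"
      by (intro prod.cong) auto
    then show ?case using x by simp
  qed
  finally show ?case .
qed

text \<open>
  With \<open>f = \<Sum> a\<^sub>k x\<^sup>k\<close> and \<open>G(x) = f(x) f(qx) \<cdots> f(q\<^sup>l x)\<close>, the left-hand side is the coefficient
  of \<open>x\<^sup>N\<close> in \<open>G(qx) - G(x)\<close>.
\<close>

lemma sum_q_shift_eq_0:
  fixes q :: "'a::comm_ring_1"
  assumes "q ^ N = 1"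
  shows "(\<Sum>n\<le>N. (q ^ ((l + 1) * (N - n)) - 1) * a (N - n)
           * (\<Sum>k\<in>weak_compositions l n. \<Prod>j=1..l. q ^ (j * k j) * a (k j))) = 0"
proof -
  define F where "F j = Abs_fps (\<lambda>k. q ^ (j * k) * a k)" for j
  have nth_F: "fps_nth (F j) k = q ^ (j * k) * a k" for j k
    by (simp add: F_def)
  have "(\<Sum>n\<le>N. (q ^ ((l + 1) * (N - n)) - 1) * a (N - n)
           * (\<Sum>k\<in>weak_compositions l n. \<Prod>j=1..l. q ^ (j * k j) * a (k j)))
      = fps_nth ((\<Prod>j=1..l. F j) * (F (Suc l) - F 0)) N"
    unfolding fps_mult_nth fps_sub_nth fps_nth_prod_weak_compositions nth_F atMost_atLeast0
    by (intro sum.cong refl)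
      (simp add: left_diff_distrib right_diff_distrib mult.commute mult.left_commute del: mult_Suc)
  \<comment> \<open>The second product is \<open>F 0 * ... * F l\<close>, reindexed so that both
    products expand over \<open>weak_compositions (Suc l) N\<close>.\<close>
  also have "(\<Prod>j=1..l. F j) * (F (Suc l) - F 0) = (\<Prod>j=1..Suc l. F j) - (\<Prod>j=1..Suc l. F (j - 1))"
  proof -
    have "(\<Prod>j=1..Suc l. F (j - 1)) = (\<Prod>j=0..l. F j)"
      by (rule prod.reindex_bij_witness[of _ Suc "\<lambda>j. j - 1"]) auto
    also have "\<dots> = F 0 * (\<Prod>j=1..l. F j)"
      by (simp add: prod.atLeast_Suc_atMost)
    finally show ?thesis by (simp add: algebra_simps)
  qed
  also have "fps_nth \<dots> N = 0"
  proof -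
    \<comment> \<open>\<open>F j\<close> arises from \<open>F (j - 1)\<close> by substituting
      \<open>q x\<close> for \<open>x\<close>, so entry \<open>k j\<close> contributes
      \<open>q ^ k j\<close>; the entries sum to \<open>N\<close>, so the total factor is
      \<open>q ^ N = 1\<close>.\<close>
    have "(\<Prod>j=1..Suc l. fps_nth (F j) (k j)) = (\<Prod>j=1..Suc l. fps_nth (F (j - 1)) (k j))"
      if k: "k \<in> weak_compositions (Suc l) N" for k
    proof -
      have "(\<Prod>j=1..Suc l. fps_nth (F j) (k j))
          = (\<Prod>j=1..Suc l. q ^ k j * fps_nth (F (j - 1)) (k j))"
      proof (intro prod.cong refl)
        fix j assume "j \<in> {1..Suc l}"
        then obtain i where "j = Suc i" by (cases j) auto
        then show "fps_nth (F j) (k j) = q ^ k j * fps_nth (F (j - 1)) (k j)"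
          by (simp add: nth_F power_add mult.assoc)
      qed
      also have "\<dots> = q ^ (\<Sum>j=1..Suc l. k j) * (\<Prod>j=1..Suc l. fps_nth (F (j - 1)) (k j))"
        by (simp only: prod.distrib power_sum)
      finally show ?thesis using k assms by (simp add: weak_compositions_def)
    qed
    then show ?thesis
      by (simp only: fps_sub_nth fps_nth_prod_weak_compositions) (simp cong: sum.cong)
  qed
  finally show ?thesis .
qed

section \<open>Identities for q-integers and q-factorials in any field\<close>

lemma one_minus_times_q_int: "(1 - q) * q_int q n = 1 - q ^ n"
  unfolding q_int_def by (rule one_diff_power_eq[symmetric])

lemma q_fact_0 [simp]: "q_fact q 0 = 1"
  by (simp add: q_fact_def)

lemma q_fact_Suc: "q_fact q (Suc n) = q_fact q n * q_int q (Suc n)"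
  by (simp add: q_fact_def)

text \<open>Brings \<open>S_sum\<close> into the shape of the inner sum of
  \<open>sum_q_shift_eq_0\<close> with \<open>a k = 1 / q_fact q k ^ m\<close>.\<close>

lemma S_sum_eq:
  "S_sum l m n q = q_fact q n ^ m *
     (\<Sum>k\<in>weak_compositions l n. \<Prod>j=1..l. q ^ (j * k j) * (1 / q_fact q (k j) ^ m))"
  unfolding S_sum_def sum_distrib_left q_multinomial_def
  by (intro sum.cong refl)
    (simp add: power_sum prod.distrib power_divide prod_power_distrib prod_dividef)

section \<open>The relation at a primitive \<open>N\<close>-th root of unity\<close>

locale primitive_root =
  fixes q :: "'a::field" and N :: nat
  assumes N_gt_1: "N > 1"
    and power_N: "q ^ N = 1"
    and power_neq_1: "\<And>k. 0 < k \<Longrightarrow> k < N \<Longrightarrow> q ^ k \<noteq> 1"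
begin

lemma neq_0: "q \<noteq> 0"
  using power_N N_gt_1 by (auto simp: power_0_left)

lemma neq_1: "q \<noteq> 1"
  using power_neq_1[of 1] N_gt_1 by simp

lemma q_int_neq_0: "0 < n \<Longrightarrow> n < N \<Longrightarrow> q_int q n \<noteq> 0"
  using one_minus_times_q_int[of q n] power_neq_1[of n] by auto

lemma q_fact_neq_0: "n < N \<Longrightarrow> q_fact q n \<noteq> 0"
  by (auto simp: q_fact_def q_int_neq_0)

text \<open>Since \<open>q ^ N = 1\<close>,
  \<open>1 - q ^ n = - (q ^ n * (1 - q ^ (N - n)))\<close>; then cancel
  \<open>1 - q\<close>.\<close>

lemma q_int_reflect:
  assumes "n \<le> N"
  shows "q_int q n = - (q ^ n * q_int q (N - n))"
proof -
  have "q ^ n * q ^ (N - n) = 1"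
    using assms power_N by (simp flip: power_add)
  then have "- (q ^ n * ((1 - q) * q_int q (N - n))) = (1 - q) * q_int q n"
    unfolding one_minus_times_q_int by (simp add: right_diff_distrib)
  then have "(1 - q) * q_int q n = (1 - q) * - (q ^ n * q_int q (N - n))"
    by (simp add: mult.left_commute)
  then show ?thesis using neq_1 unfolding mult_cancel_left by simp
qed

text \<open>Raising \<open>n\<close> by one replaces the factor \<open>q_int q (N - Suc n)\<close>
  by \<open>q_int q (Suc n)\<close>, which costs \<open>- (q ^ Suc n)\<close> by
  \<open>q_int_reflect\<close>. The exponents add up to \<open>1 + ... + n\<close>.\<close>

lemma q_fact_reflect:
  assumes "n < N"
  shows "q_fact q n * q_fact q (N - Suc n) = (- 1) ^ n * q ^ (Suc n choose 2) * q_fact q (N - 1)"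
  using assms
proof (induction n)
  case 0
  then show ?case by (simp add: numeral_2_eq_2)
next
  case (Suc n)
  have "N - Suc n = Suc (N - Suc (Suc n))" using Suc.prems by simp
  then have fact: "q_fact q (N - Suc n) = q_fact q (N - Suc (Suc n)) * q_int q (N - Suc n)"
    by (metis q_fact_Suc)
  have "q_fact q (Suc n) * q_fact q (N - Suc (Suc n))
      = - (q ^ Suc n) * (q_fact q n * q_fact q (N - Suc n))"
    using q_int_reflect[of "Suc n"] Suc.prems by (simp add: q_fact_Suc fact)
  also have "\<dots> = (- 1) ^ Suc n * q ^ (Suc (Suc n) choose 2) * q_fact q (N - 1)"
    using Suc by (simp add: numeral_2_eq_2 power_add)
  finally show ?case .
qed

text \<open>This is \<open>q_fact_reflect\<close> at \<open>n - 1\<close>, multiplied by the missing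
  factor \<open>q_int q n\<close>; the signs \<open>(- 1) ^ n\<close> and
  \<open>(- 1) ^ (n - 1)\<close> combine to \<open>- 1\<close>.\<close>

lemma sign_power_div_q_int:
  assumes "0 < n" "n < N"
  shows "(- 1) ^ n / q ^ (n choose 2) / q_int q n
      = - q_fact q (N - 1) / (q_fact q n * q_fact q (N - n))"
proof -
  obtain i where i: "n = Suc i" using assms gr0_implies_Suc by blast
  have nz: "q_fact q (N - n) \<noteq> 0" "q_fact q i \<noteq> 0" "q_int q n \<noteq> 0"
    using assms i by (auto simp: q_fact_neq_0 q_int_neq_0)
  have s: "(- 1 :: 'a) ^ i * (- 1) ^ i = 1" by (simp flip: power_mult_distrib)
  have "(- 1) ^ n * (q_fact q n * q_fact q (N - n))
      = (- 1) ^ n * q_int q n * (q_fact q i * q_fact q (N - Suc i))"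
    by (simp add: i q_fact_Suc)
  also have "\<dots> = - q_fact q (N - 1) * (q ^ (n choose 2) * q_int q n) * ((- 1) ^ i * (- 1) ^ i)"
    using q_fact_reflect[of i] assms by (simp add: i)
  finally have *: "(- 1) ^ n * (q_fact q n * q_fact q (N - n))
      = - q_fact q (N - 1) * (q ^ (n choose 2) * q_int q n)"
    by (simp only: s mult_1_right)
  then show ?thesis
    using nz neq_0 assms unfolding divide_divide_eq_left
    by (subst frac_eq_eq) (auto simp: q_fact_neq_0)
qed

text \<open>The geometric sums collapse to \<open>1 - q ^ ((l + 1) * n)\<close>, and
  \<open>q ^ N = 1\<close> makes \<open>q ^ ((l + 1) * (N - n))\<close> the inverse of
  \<open>q ^ ((l + 1) * n)\<close>.\<close>

lemma q_int_mult_reflect: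
  assumes "n \<le> N"
  shows "(1 - q) * (q powi (- ((int l + 1) * int n)) * (q_int q n * q_int (q ^ n) (l + 1)))
    = q ^ ((l + 1) * (N - n)) - 1"
proof -
  have e: "(l + 1) * n + (l + 1) * (N - n) = N * (l + 1)"
    using assms by (metis distrib_left le_add_diff_inverse mult.commute)
  have reflect: "q ^ ((l + 1) * n) * q ^ ((l + 1) * (N - n)) = 1"
    unfolding power_add[symmetric] e power_mult[of q N] power_N by (rule power_one)
  have "(int l + 1) * int n = int ((l + 1) * n)" by (simp add: distrib_right)
  then have inv: "q powi (- ((int l + 1) * int n)) = q ^ ((l + 1) * (N - n))"
    by (simp only: power_int_minus power_int_of_nat inverse_unique[OF reflect])
  have "(1 - q) * (q ^ ((l + 1) * (N - n)) * (q_int q n * q_int (q ^ n) (l + 1)))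
      = q ^ ((l + 1) * (N - n)) * ((1 - q) * q_int q n * q_int (q ^ n) (l + 1))"
    by (simp only: mult_ac)
  also have "\<dots> = q ^ ((l + 1) * (N - n)) * (1 - q ^ ((l + 1) * n))"
    by (simp only: one_minus_times_q_int power_mult[symmetric] mult.commute[of n])
  also have "\<dots> = q ^ ((l + 1) * (N - n)) - 1"
    unfolding right_diff_distrib mult.commute[of _ "q ^ ((l + 1) * n)"] reflect by simp
  finally show ?thesis unfolding inv .
qed

text \<open>After multiplication by the nonzero \<open>1 - q\<close>, each term is a constant
  \<open>c\<close> times the matching term of \<open>sum_q_shift_eq_0\<close>.\<close>

lemma S_sum_relation:
  "(\<Sum>n\<in>{0<..<N}. (- 1) ^ (m * n)
      * q powi (- (int m * int (n choose 2)) - (int l + 1) * int n)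
      / q_int q n powi (int m - 1) * q_int (q ^ n) (l + 1) * S_sum l m n q) = 0"
    (is "(\<Sum>n\<in>_. ?t n) = 0")
proof -
  \<comment> \<open>\<open>a N\<close> is a junk value, since \<open>q_fact q N = 0\<close>; below it is multiplied by \<open>q ^ ((l + 1) * N) - 1 = 0\<close>.\<close>
  define a where "a k = 1 / q_fact q k ^ m" for k
  define s where "s n = (\<Sum>k\<in>weak_compositions l n. \<Prod>j=1..l. q ^ (j * k j) * a (k j))" for n
  define c where "c = (- q_fact q (N - 1)) ^ m"
  have t: "(1 - q) * ?t n = c * ((q ^ ((l + 1) * (N - n)) - 1) * a (N - n) * s n)"
    if n: "n \<in> {0<..<N}" for n
  proof -
    have nz: "q_int q n \<noteq> 0" "q_fact q n \<noteq> 0"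
      using n by (auto simp: q_int_neq_0 q_fact_neq_0)
    have S: "S_sum l m n q = q_fact q n ^ m * s n"
      by (simp add: S_sum_eq s_def a_def)
    \<comment> \<open>Writing \<open>q_int q n powi (int m - 1)\<close> as
      \<open>q_int q n ^ m / q_int q n\<close> collects an \<open>m\<close>-th power and leaves one
      \<open>q_int q n\<close> for \<open>q_int_mult_reflect\<close>.\<close>
    have "?t n = (((- 1) ^ n / q ^ (n choose 2) / q_int q n) ^ m * q_int q n)
        * q powi (- ((int l + 1) * int n)) * q_int (q ^ n) (l + 1) * S_sum l m n q"
    proof -
      have "int m * int (n choose 2) = int ((n choose 2) * m)" by simp
      then have "q powi (- (int m * int (n choose 2)) - (int l + 1) * int n)
          = 1 / (q ^ (n choose 2)) ^ m * q powi (- ((int l + 1) * int n))"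
        using neq_0
        by (simp only: diff_conv_add_uminus power_int_add power_int_minus power_int_of_nat
          power_mult inverse_eq_divide simp_thms)
      moreover have "q_int q n powi (int m - 1) = q_int q n ^ m / q_int q n"
        using nz by (simp add: power_int_diff)
      moreover have "(- 1 :: 'a) ^ (m * n) = ((- 1) ^ n) ^ m"
        unfolding power_mult[symmetric] by (simp only: mult.commute)
      moreover have "u ^ m * (1 / v ^ m * x) / (w ^ m / w) * y * z = ((u / v / w) ^ m * w) * x * y * z"
        for u v w x y z :: 'a
        by (simp add: power_divide power_mult_distrib)
      ultimately show ?thesis by (simp only:)
    qed
    also have "(- 1) ^ n / q ^ (n choose 2) / q_int q n
        = - q_fact q (N - 1) / (q_fact q n * q_fact q (N - n))"
      using n by (intro sign_power_div_q_int) auto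
    \<comment> \<open>The power \<open>q_fact q n ^ m\<close> coming from \<open>S_sum\<close>
      cancels, leaving \<open>1 / q_fact q (N - n) ^ m = a (N - n)\<close>.\<close>
    also have "(\<dots> ^ m * q_int q n) * q powi (- ((int l + 1) * int n)) * q_int (q ^ n) (l + 1)
          * S_sum l m n q
        = c * (q powi (- ((int l + 1) * int n)) * (q_int q n * q_int (q ^ n) (l + 1)))
          * a (N - n) * s n"
      using nz n by (simp add: S c_def a_def power_divide power_mult_distrib del: divide_minus_left)
    finally have "?t n = c * (q powi (- ((int l + 1) * int n)) * (q_int q n * q_int (q ^ n) (l + 1)))
        * a (N - n) * s n" .
    then have "(1 - q) * ?t n
        = c * ((1 - q) * (q powi (- ((int l + 1) * int n)) * (q_int q n * q_int (q ^ n) (l + 1)))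
            * a (N - n) * s n)"
      by (simp only: mult_ac)
    moreover have "n \<le> N" using n by simp
    ultimately show ?thesis by (simp only: q_int_mult_reflect)
  qed
  have "(1 - q) * (\<Sum>n\<in>{0<..<N}. ?t n)
      = (\<Sum>n\<in>{0<..<N}. c * ((q ^ ((l + 1) * (N - n)) - 1) * a (N - n) * s n))"
    unfolding sum_distrib_left by (intro sum.cong t refl)
  also have "\<dots> = c * (\<Sum>n\<in>{0<..<N}. (q ^ ((l + 1) * (N - n)) - 1) * a (N - n) * s n)"
    by (simp only: sum_distrib_left)
  \<comment> \<open>Both endpoints may be added: the difference is
    \<open>q ^ ((l + 1) * N) - 1 = 0\<close> at \<open>n = 0\<close> and
    \<open>q ^ 0 - 1 = 0\<close> at \<open>n = N\<close>.\<close>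
  also have "(\<Sum>n\<in>{0<..<N}. (q ^ ((l + 1) * (N - n)) - 1) * a (N - n) * s n)
      = (\<Sum>n\<le>N. (q ^ ((l + 1) * (N - n)) - 1) * a (N - n) * s n)"
  proof (rule sum.mono_neutral_left)
    show "\<forall>n\<in>{..N} - {0<..<N}. (q ^ ((l + 1) * (N - n)) - 1) * a (N - n) * s n = 0"
    proof
      fix n assume "n \<in> {..N} - {0<..<N}"
      then have "n = 0 \<or> n = N" by auto
      then show "(q ^ ((l + 1) * (N - n)) - 1) * a (N - n) * s n = 0"
        using power_mult[of q N "l + 1"] power_N by (auto simp: mult.commute)
    qed
  qed auto
  also have "\<dots> = 0"
    unfolding s_def by (rule sum_q_shift_eq_0) (rule power_N)
  finally show ?thesis using neq_1 by simp
qed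

end

section \<open>Complex primitive roots of unity and the cyclotomic polynomial\<close>

definition primitive_roots :: "nat \<Rightarrow> complex set" where
  "primitive_roots N = (\<lambda>a. cis (2 * pi * real a / real N)) ` {a. a < N \<and> coprime a N}"

text \<open>If \<open>z ^ k = 1\<close>, then \<open>a * k / N\<close> is an integer, and
  coprimality of \<open>a\<close> and \<open>N\<close> forces \<open>N dvd k\<close>.\<close>

lemma primitive_root_complex:
  assumes "N > 1" "z \<in> primitive_roots N"
  shows "primitive_root z N"
proof
  obtain a where a: "z = cis (2 * pi * real a / real N)" "a < N" "coprime a N"
    using assms by (auto simp: primitive_roots_def)
  have pw: "z ^ k = cis (2 * pi * real (a * k) / real N)" for k
    by (simp add: a DeMoivre mult_ac)
  have "2 * pi * real (a * N) / real N = 2 * pi * real a"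
    using assms by simp
  then show "z ^ N = 1"
    by (simp only: pw cis_multiple_2pi Ints_of_nat)
  show "z ^ k \<noteq> 1" if "0 < k" "k < N" for k
  proof
    assume "z ^ k = 1"
    then have "cos (2 * pi * real (a * k) / real N) = 1"
      unfolding pw by (metis cis.sel(1) one_complex.sel(1))
    then obtain x :: int where "2 * pi * real (a * k) / real N = x * 2 * pi"
      unfolding cos_one_2pi_int by auto
    then have "real (a * k) = x * real N"
      using assms by (simp add: field_simps)
    then have "int (a * k) = x * int N"
      by (metis (no_types, lifting) of_int_eq_iff of_int_mult of_int_of_nat_eq)
    then have "N dvd a * k"
      by (metis dvd_triv_right int_dvd_int_iff)
    then have "N dvd k"
      using a(3) by (simp add: coprime_commute coprime_dvd_mult_right_iff)
    with that show False by (auto dest: dvd_imp_le)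
  qed
qed fact

lemma finite_primitive_roots [simp]: "finite (primitive_roots N)"
  by (simp add: primitive_roots_def)

lemma cyclotomic_complex_eq_prod_roots:
  assumes "N > 1"
  shows "cyclotomic_complex N = (\<Prod>z\<in>primitive_roots N. [:- z, 1:])"
proof -
  have inj: "inj_on (\<lambda>a. cis (2 * pi * real a / real N)) {a. a < N \<and> coprime a N}"
    using bij_betw_roots_unity[of N] assms
    by (auto simp: bij_betw_def elim: inj_on_subset)
  \<comment> \<open>For \<open>N > 1\<close> neither 0 nor \<open>N\<close> is coprime to
    \<open>N\<close>, so the two index ranges agree.\<close>
  have "{a. 1 \<le> a \<and> a \<le> N \<and> coprime a N} = {a. a < N \<and> coprime a N}"
  proof (intro Collect_cong iffI)
    fix a assume "a < N \<and> coprime a N"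
    with assms show "1 \<le> a \<and> a \<le> N \<and> coprime a N" by (cases a) auto
  next
    fix a assume "1 \<le> a \<and> a \<le> N \<and> coprime a N"
    with assms show "a < N \<and> coprime a N" by (cases "a = N") auto
  qed
  then show ?thesis
    using inj by (simp add: cyclotomic_complex_def primitive_roots_def prod.reindex cis_conv_exp mult_ac)
qed

lemma prod_linear_dvd:
  fixes p :: "'a::field poly"
  assumes "finite A" "\<And>z. z \<in> A \<Longrightarrow> poly p z = 0"
  shows "(\<Prod>z\<in>A. [:- z, 1:]) dvd p"
  using assms
proof (induction A rule: finite_induct)
  case empty
  then show ?case by simp
next
  case (insert x A)
  then obtain r where r: "p = (\<Prod>z\<in>A. [:- z, 1:]) * r"
    by (auto elim: dvdE)
  have "poly (\<Prod>z\<in>A. [:- z, 1:]) x \<noteq> 0"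
    using insert.hyps by (auto simp: poly_prod)
  then have "poly r x = 0"
    using insert.prems[of x] r by auto
  then obtain t where "r = [:- x, 1:] * t"
    by (auto simp: poly_eq_0_iff_dvd elim: dvdE)
  then have "p = (\<Prod>z\<in>insert x A. [:- z, 1:]) * t"
    unfolding r prod.insert[OF insert.hyps] by (simp only: mult_ac)
  then show ?case by (rule dvdI)
qed

text \<open>Division with remainder over the rationals survives the embedding: a nonzero remainder
  would be a multiple of \<open>p\<close> over the complex numbers, but of smaller degree.\<close>

lemma rat_cpoly_dvdD:
  assumes "rat_cpoly p dvd rat_cpoly r" "p \<noteq> 0"
  shows "p dvd r"
proof (rule ccontr)
  assume "\<not> p dvd r"
  then have nz: "r mod p \<noteq> 0" by (simp add: dvd_eq_mod_eq_0)
  have "rat_cpoly r = rat_cpoly p * rat_cpoly (r div p) + rat_cpoly (r mod p)"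
    by (simp flip: rat_cpoly_mult rat_cpoly_add)
  with assms(1) have "rat_cpoly p dvd rat_cpoly (r mod p)"
    by (simp add: dvd_add_right_iff)
  moreover have "rat_cpoly (r mod p) \<noteq> 0"
    using nz by (metis map_poly_0 rat_cpoly_eq_iff)
  ultimately have "degree p \<le> degree (r mod p)"
    by (metis dvd_imp_degree_le degree_rat_cpoly)
  with degree_mod_less[OF assms(2), of r] nz show False by auto
qed

lemma rat_cpoly_cyclotomic:
  "N > 1 \<Longrightarrow> rat_cpoly (cyclotomic N) = (\<Prod>z\<in>primitive_roots N. [:- z, 1:])"
  by (simp add: of_rat_cyclotomic cyclotomic_complex_eq_prod_roots)

lemma cyclotomic_dvdI:
  assumes "N > 1" "\<And>z. z \<in> primitive_roots N \<Longrightarrow> poly (rat_cpoly p) z = 0"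
  shows "cyclotomic N dvd p"
proof (rule rat_cpoly_dvdD)
  show "rat_cpoly (cyclotomic N) dvd rat_cpoly p"
    using assms by (simp add: rat_cpoly_cyclotomic prod_linear_dvd)
  show "cyclotomic N \<noteq> 0"
    using rat_cpoly_cyclotomic[OF assms(1)] by auto
qed

text \<open>A nonunit common divisor has a complex root, which is a primitive root at which
  \<open>p\<close> vanishes.\<close>

lemma coprime_cyclotomicI:
  assumes "N > 1" "\<And>z. z \<in> primitive_roots N \<Longrightarrow> poly (rat_cpoly p) z \<noteq> 0"
  shows "coprime p (cyclotomic N)"
proof (rule coprimeI)
  fix d assume d: "d dvd p" "d dvd cyclotomic N"
  have cycl: "cyclotomic N \<noteq> 0"
    using rat_cpoly_cyclotomic[OF assms(1)] by auto
  show "is_unit d"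
  proof (rule ccontr)
    assume "\<not> is_unit d"
    moreover have "d \<noteq> 0" using d(2) cycl by auto
    ultimately have "degree (rat_cpoly d) \<noteq> 0"
      by (simp add: is_unit_iff_degree degree_rat_cpoly)
    then obtain z where z: "poly (rat_cpoly d) z = 0"
      using fundamental_theorem_of_algebra_alt[of "rat_cpoly d"] by (metis degree_pCons_0)
    have "poly (rat_cpoly p) z = 0" "poly (rat_cpoly (cyclotomic N)) z = 0"
      using d z by (auto elim!: dvdE simp: rat_cpoly_mult)
    moreover from this(2) have "z \<in> primitive_roots N"
      using assms(1) by (auto simp: rat_cpoly_cyclotomic poly_prod)
    ultimately show False using assms(2) by blast
  qed
qed

section \<open>Specialization of rational functions at complex points\<close>

text \<open>
  The rational function \<open>A\<close> is regular on \<open>Z\<close>, uniformly in the denominator, and takes the values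
  \<open>f z\<close> there.
\<close>

definition specializes :: "complex set \<Rightarrow> rat poly fract \<Rightarrow> (complex \<Rightarrow> complex) \<Rightarrow> bool" where
  "specializes Z A f \<longleftrightarrow> (\<exists>P C. C \<noteq> 0 \<and> A = to_fract P / to_fract C \<and>
     (\<forall>z\<in>Z. poly (rat_cpoly C) z \<noteq> 0 \<and> f z = poly (rat_cpoly P) z / poly (rat_cpoly C) z))"

named_theorems specializes_intros

lemma specializes_poly:
  "(\<And>z. z \<in> Z \<Longrightarrow> f z = poly (rat_cpoly P) z) \<Longrightarrow> specializes Z (to_fract P) f"
  unfolding specializes_def by (intro exI[of _ P] exI[of _ 1]) simp

lemma specializes_0: "specializes Z 0 (\<lambda>_. 0)"
  using specializes_poly[of Z _ 0] by simp

lemma specializes_1 [specializes_intros]: "specializes Z 1 (\<lambda>_. 1)"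
  using specializes_poly[of Z _ 1] by simp

lemma specializes_indet [specializes_intros]: "specializes Z indet (\<lambda>z. z)"
  unfolding indet_def by (rule specializes_poly) (simp add: map_poly_pCons)

lemma specializes_mult [specializes_intros]:
  assumes "specializes Z A f" "specializes Z B g"
  shows "specializes Z (A * B) (\<lambda>z. f z * g z)"
proof -
  from assms obtain P C Q D where
    "C \<noteq> 0" "A = to_fract P / to_fract C"
    "\<forall>z\<in>Z. poly (rat_cpoly C) z \<noteq> 0 \<and> f z = poly (rat_cpoly P) z / poly (rat_cpoly C) z"
    "D \<noteq> 0" "B = to_fract Q / to_fract D"
    "\<forall>z\<in>Z. poly (rat_cpoly D) z \<noteq> 0 \<and> g z = poly (rat_cpoly Q) z / poly (rat_cpoly D) z"
    unfolding specializes_def by metis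
  then show ?thesis
    unfolding specializes_def
    by (intro exI[of _ "P * Q"] exI[of _ "C * D"]) (simp add: rat_cpoly_mult)
qed

lemma specializes_add [specializes_intros]:
  assumes "specializes Z A f" "specializes Z B g"
  shows "specializes Z (A + B) (\<lambda>z. f z + g z)"
proof -
  from assms obtain P C Q D where
    "C \<noteq> 0" "A = to_fract P / to_fract C"
    "\<forall>z\<in>Z. poly (rat_cpoly C) z \<noteq> 0 \<and> f z = poly (rat_cpoly P) z / poly (rat_cpoly C) z"
    "D \<noteq> 0" "B = to_fract Q / to_fract D"
    "\<forall>z\<in>Z. poly (rat_cpoly D) z \<noteq> 0 \<and> g z = poly (rat_cpoly Q) z / poly (rat_cpoly D) z"
    unfolding specializes_def by metis
  then show ?thesis
    unfolding specializes_def
    by (intro exI[of _ "P * D + Q * C"] exI[of _ "C * D"])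
      (simp add: rat_cpoly_mult rat_cpoly_add add_frac_eq)
qed

lemma specializes_inverse:
  assumes "specializes Z A f" "\<And>z. z \<in> Z \<Longrightarrow> f z \<noteq> 0"
  shows "specializes Z (inverse A) (\<lambda>z. inverse (f z))"
proof -
  from assms(1) obtain P C where PC: "C \<noteq> 0" "A = to_fract P / to_fract C"
    "\<forall>z\<in>Z. poly (rat_cpoly C) z \<noteq> 0 \<and> f z = poly (rat_cpoly P) z / poly (rat_cpoly C) z"
    unfolding specializes_def by metis
  show ?thesis
  proof (cases "P = 0")
    \<comment> \<open>As \<open>f\<close> has no zero on \<open>Z\<close>, a zero numerator is
      possible only for empty \<open>Z\<close>; then \<open>inverse A = 0\<close> is represented as
      \<open>0 / 1\<close>.\<close>
    case True
    with assms(2) PC have "Z = {}" by auto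
    with True PC show ?thesis
      unfolding specializes_def by (intro exI[of _ 0] exI[of _ 1]) simp
  next
    case False
    with assms(2) PC show ?thesis
      unfolding specializes_def by (intro exI[of _ C] exI[of _ P]) auto
  qed
qed

lemma specializes_divide [specializes_intros]:
  assumes "specializes Z A f" "specializes Z B g" "\<And>z. z \<in> Z \<Longrightarrow> g z \<noteq> 0"
  shows "specializes Z (A / B) (\<lambda>z. f z / g z)"
  using assms unfolding divide_inverse by (intro specializes_mult specializes_inverse)

lemma specializes_uminus [specializes_intros]:
  assumes "specializes Z A f"
  shows "specializes Z (- A) (\<lambda>z. - f z)"
proof -
  have "specializes Z (to_fract [:- 1:] * A) (\<lambda>z. - 1 * f z)"
    by (intro specializes_mult specializes_poly assms) (simp add: map_poly_pCons)
  moreover have "to_fract [:- 1 :: rat:] = - 1"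
    by (simp add: one_pCons flip: to_fract_1 to_fract_uminus)
  ultimately show ?thesis by simp
qed

lemma specializes_power [specializes_intros]:
  "specializes Z A f \<Longrightarrow> specializes Z (A ^ n) (\<lambda>z. f z ^ n)"
  by (induction n) (auto intro: specializes_intros)

lemma specializes_power_int [specializes_intros]:
  assumes "specializes Z A f" "\<And>z. z \<in> Z \<Longrightarrow> f z \<noteq> 0"
  shows "specializes Z (A powi i) (\<lambda>z. f z powi i)"
  using assms unfolding power_int_def
  by (cases "i \<ge> 0") (auto intro!: specializes_power specializes_inverse)

lemma specializes_sum [specializes_intros]:
  assumes "\<And>x. x \<in> I \<Longrightarrow> specializes Z (A x) (f x)"
  shows "specializes Z (\<Sum>x\<in>I. A x) (\<lambda>z. \<Sum>x\<in>I. f x z)"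
  using assms
  by (induction I rule: infinite_finite_induct) (auto intro: specializes_intros specializes_0)

lemma specializes_prod [specializes_intros]:
  assumes "\<And>x. x \<in> I \<Longrightarrow> specializes Z (A x) (f x)"
  shows "specializes Z (\<Prod>x\<in>I. A x) (\<lambda>z. \<Prod>x\<in>I. f x z)"
  using assms
  by (induction I rule: infinite_finite_induct) (auto intro: specializes_intros)

lemma specializes_q_int [specializes_intros]:
  "specializes Z A f \<Longrightarrow> specializes Z (q_int A n) (\<lambda>z. q_int (f z) n)"
  unfolding q_int_def by (intro specializes_intros)

lemma specializes_q_fact [specializes_intros]:
  "specializes Z A f \<Longrightarrow> specializes Z (q_fact A n) (\<lambda>z. q_fact (f z) n)"
  unfolding q_fact_def by (intro specializes_intros)

section \<open>From vanishing at the primitive roots to the congruence\<close>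

lemma ratfun_cong_0I:
  assumes "N > 1" "specializes (primitive_roots N) A f"
    and "\<And>z. z \<in> primitive_roots N \<Longrightarrow> f z = 0"
  shows "ratfun_cong_0 A (cyclotomic N)"
proof -
  from assms(2) obtain P C where PC: "C \<noteq> 0" "A = to_fract P / to_fract C"
    "\<forall>z\<in>primitive_roots N. poly (rat_cpoly C) z \<noteq> 0 \<and> f z = poly (rat_cpoly P) z / poly (rat_cpoly C) z"
    unfolding specializes_def by metis
  \<comment> \<open>The numerator vanishes at every primitive root, the denominator at none.\<close>
  then have "cyclotomic N dvd P" "coprime C (cyclotomic N)"
    using assms(1,3) by (auto intro!: cyclotomic_dvdI coprime_cyclotomicI)
  with PC(1,2) show ?thesis
    unfolding ratfun_cong_0_def by (metis dvdE to_fract_mult)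
qed

theorem theorem2:
  fixes l m N :: nat
  assumes "l > 0" and "N > 1"
  shows "ratfun_cong_0
    (\<Sum>n\<in>{0<..<N}.
        (- 1) ^ (m * n)
          * indet powi (- (int m * int (n choose 2)) - (int l + 1) * int n)
          / q_int indet n powi (int m - 1)
        * q_int (indet ^ n) (l + 1)
        * S_sum l m n indet)
    (cyclotomic N)"
proof (rule ratfun_cong_0I[OF \<open>N > 1\<close>])
  let ?Z = "primitive_roots N"
  have root: "primitive_root z N" if "z \<in> ?Z" for z
    using primitive_root_complex[OF \<open>N > 1\<close> that] .
  \<comment> \<open>Every entry of a composition of \<open>n < N\<close> is below \<open>N\<close>,
    so no q-factorial in a denominator vanishes.\<close>
  have S: "specializes ?Z (S_sum l m n indet) (S_sum l m n)" if "n < N" for n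
    unfolding S_sum_def q_multinomial_def using that
    by (intro specializes_intros)
      (auto dest!: root weak_compositions_le simp: primitive_root.q_fact_neq_0)
  show "specializes ?Z
    (\<Sum>n\<in>{0<..<N}.
        (- 1) ^ (m * n)
          * indet powi (- (int m * int (n choose 2)) - (int l + 1) * int n)
          / q_int indet n powi (int m - 1)
        * q_int (indet ^ n) (l + 1)
        * S_sum l m n indet)
    (\<lambda>z. \<Sum>n\<in>{0<..<N}.
        (- 1) ^ (m * n)
          * z powi (- (int m * int (n choose 2)) - (int l + 1) * int n)
          / q_int z n powi (int m - 1)
        * q_int (z ^ n) (l + 1)
        * S_sum l m n z)"
    \<comment> \<open>The negative powers are regular because \<open>z\<close> and
      \<open>q_int z n\<close>, for \<open>0 < n < N\<close>, are nonzero at primitive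
      roots.\<close>
    by (intro specializes_intros S)
      (auto dest!: root dest: primitive_root.neq_0 simp: primitive_root.q_int_neq_0)
qed (rule primitive_root.S_sum_relation[OF primitive_root_complex[OF \<open>N > 1\<close>]])

end
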